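(* Let $k\geq 3$ and $n\ge 1$. There is a bijection $f$ from the set $\mathcal{S}_n(G_k)$ of permutations of $[n]$ avoiding $G_k=1\,2\,\cdots\,(k-2)\,k\,(k-1)$ to the set $\mathcal{S}_n(H_k,Q_k)$ of permutations of $[n]$ avoiding both $H_k$ and $Q_k$, such that $\mathcal{D}(f(\pi))=\mathcal{D}(\pi)$ for every $\pi\in\mathcal{S}_n(G_k)$.
   Context: For $\pi=\pi_1\cdots\pi_n$ a permutation of $[n]$, $\mathcal{D}(\pi)=\{i:\pi_i>\pi_{i+1}\}$ is its descent set. A subsequence $\pi_{i_1}\cdots\pi_{i_k}$ ($i_1<\cdots<i_k$) is order-isomorphic to a pattern $\tau$ if its entries appear in the same relative order as $\tau$; $\pi$ avoids $\tau$ if no such subsequence exists. Let $J_k=12\cdots k$ and $G_k=1\,2\cdots(k-2)\,k\,(k-1)$. We say $\pi$ contains an occurrence of $H_k$ if there exist indices $i_1<\cdots<i_k$ such that $\pi_{i_1}\cdots\pi_{i_k}$ is order-isomorphic to $J_k$ and there exists $j\in\mathcal{D}(\pi)$ with $i_{k-1}\le j<i_k$; otherwise $\pi$ avoids $H_k$. We say $\pi$ contains an occurrence of $Q_k$ if there exist indices $i_1<\cdots<i_k$ such that $\pi_{i_1}\cdots\pi_{i_k}$ is order-isomorphic to $G_k$ and $\pi_{i_{k-1}}<\pi_{i_{k-1}+1}<\cdots<\pi_{i_k-1}>\pi_{i_k}$; otherwise $\pi$ avoids $Q_k$. $\mathcal{S}_n(H_k,Q_k)$ is the set of permutations of $[n]$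 avoiding both $H_k$ and $Q_k$. *)

theory Defs
  imports "HOL-Combinatorics.Permutations"
begin

text \<open>
  A permutation of $[n]$ is a function \<open>p\<close> with \<open>p permutes {1..n}\<close>; its one-line notation is
  \<open>p 1, \<dots>, p n\<close>. Since such a function is the identity outside \<open>{1..n}\<close>, these functions
  correspond exactly to the permutations of $[n]$. Words and index sequences are functions on
  \<open>{1..k}\<close>, and their values elsewhere are irrelevant.
\<close>

definition descent_set :: "nat \<Rightarrow> (nat \<Rightarrow> nat) \<Rightarrow> nat set" where
  "descent_set n p = {i. 1 \<le> i \<and> i < n \<and> p i > p (i + 1)}"

definition order_isomorphic :: "nat \<Rightarrow> (nat \<Rightarrow> nat) \<Rightarrow> (nat \<Rightarrow> nat) \<Rightarrow> bool" where
  "order_isomorphic k w t \<longleftrightarrow> (\<forall>a\<in>{1..k}. \<forall>b\<in>{1..k}. w a < w b \<longleftrightarrow> t a < t b)"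

definition pattern_occurrence ::
    "nat \<Rightarrow> nat \<Rightarrow> (nat \<Rightarrow> nat) \<Rightarrow> (nat \<Rightarrow> nat) \<Rightarrow> (nat \<Rightarrow> nat) \<Rightarrow> bool" where
  "pattern_occurrence n k t p ix \<longleftrightarrow>
     ix ` {1..k} \<subseteq> {1..n} \<and> strict_mono_on {1..k} ix \<and> order_isomorphic k (p \<circ> ix) t"

definition J_pattern :: "nat \<Rightarrow> nat \<Rightarrow> nat" where
  "J_pattern k = (\<lambda>a. a)"

definition G_pattern :: "nat \<Rightarrow> nat \<Rightarrow> nat" where
  "G_pattern k = (\<lambda>a. if a = k - 1 then k else if a = k then k - 1 else a)"

definition contains_H :: "nat \<Rightarrow> nat \<Rightarrow> (nat \<Rightarrow> nat) \<Rightarrow> bool" where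
  "contains_H n k p \<longleftrightarrow>
     (\<exists>ix. pattern_occurrence n k (J_pattern k) p ix \<and>
           (\<exists>j\<in>descent_set n p. ix (k - 1) \<le> j \<and> j < ix k))"

definition contains_Q :: "nat \<Rightarrow> nat \<Rightarrow> (nat \<Rightarrow> nat) \<Rightarrow> bool" where
  "contains_Q n k p \<longleftrightarrow>
     (\<exists>ix. pattern_occurrence n k (G_pattern k) p ix \<and>
           (\<forall>j. ix (k - 1) \<le> j \<and> j < ix k - 1 \<longrightarrow> p j < p (j + 1)) \<and>
           p (ix k - 1) > p (ix k))"

definition perms_avoiding :: "nat \<Rightarrow> nat \<Rightarrow> (nat \<Rightarrow> nat) \<Rightarrow> (nat \<Rightarrow> nat) set" where
  "perms_avoiding n k t = {p. p permutes {1..n} \<and> \<not> (\<exists>ix. pattern_occurrence n k t p ix)}"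

definition perms_avoiding_HQ :: "nat \<Rightarrow> nat \<Rightarrow> (nat \<Rightarrow> nat) set" where
  "perms_avoiding_HQ n k = {p. p permutes {1..n} \<and> \<not> contains_H n k p \<and> \<not> contains_Q n k p}"

end

theory Submission
  imports Defs
begin

text \<open>
  Put \<open>K = k - 2\<close> and call a position high if an increasing subsequence of length \<open>K\<close> lies to its
  left and below it, and low otherwise. Moving high entries around while keeping them high does
  not change which positions are high, so permutations fall into classes sharing the low positions
  and the low entries. Each class contains exactly one permutation avoiding \<open>G\<^sub>k\<close> (at every high
  position, the smallest remaining value that keeps it high) and exactly one avoiding \<open>H\<^sub>k\<close> and
  \<open>Q\<^sub>k\<close> (blocks of consecutive high positions increase, and every block lies above the next one).
  In both of them all steps inside a block are ascents; since a step from low to high is always an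
  ascent and a step from high to low always a descent, the descent set depends on the class only.
\<close>

declare One_nat_def [simp del]

section \<open>Increasing chains to the left of and below a point\<close>

text \<open>Peeling off the last entry first suits induction. The bounds \<open>c\<close> and
  \<open>v\<close> are separate arguments so that one can ask whether a value \<open>v\<close>
  standing elsewhere would make position \<open>c\<close> high.\<close>

primrec chain :: "nat set \<Rightarrow> (nat \<Rightarrow> nat) \<Rightarrow> nat \<Rightarrow> nat \<Rightarrow> nat \<Rightarrow> bool" where
  "chain A p 0 c v \<longleftrightarrow> True"
| "chain A p (Suc r) c v \<longleftrightarrow> (\<exists>c'\<in>A. c' < c \<and> p c' < v \<and> chain A p r c' (p c'))"

lemma chain_mono: "chain A p r c v \<Longrightarrow> c \<le> c' \<Longrightarrow> v \<le> v' \<Longrightarrow> chain A p r c' v'"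
  by (cases r) (auto dest: order.strict_trans2)

lemma chain_SucD: "chain A p (Suc r) c v \<Longrightarrow> chain A p r c v"
proof (induction r arbitrary: c v)
  case (Suc r)
  then obtain c' where "c' \<in> A" "c' < c" "p c' < v" "chain A p (Suc r) c' (p c')"
    by auto
  with Suc.IH show ?case by auto
qed simp

lemma chain_le: "chain A p r c v \<Longrightarrow> s \<le> r \<Longrightarrow> chain A p s c v"
proof (induction r)
  case (Suc r)
  show ?case
  proof (cases "s = Suc r")
    case False
    then show ?thesis using Suc.IH[OF chain_SucD[OF Suc.prems(1)]] Suc.prems(2) by linarith
  qed (use Suc.prems in simp)
qed simp

lemma chain_cong:
  assumes "\<And>i. i \<in> A \<Longrightarrow> p i = q i"
  shows "chain A p r c v \<longleftrightarrow> chain A q r c v"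
  using assms by (induction r arbitrary: c v) auto

lemma chain_subset: "chain A p r c v \<Longrightarrow> A \<subseteq> B \<Longrightarrow> chain B p r c v"
  by (induction r arbitrary: c v) auto

text \<open>Bridge from the recursion to the index sequences of \<open>pattern_occurrence\<close>;
  the outermost entry of the recursion becomes the index at \<open>Suc r\<close>.\<close>

lemma chain_iff_index:
  "chain A p r c v \<longleftrightarrow>
     (\<exists>ix. ix ` {1..r} \<subseteq> A \<and> strict_mono_on {1..r} ix \<and> strict_mono_on {1..r} (p \<circ> ix) \<and>
           (\<forall>a\<in>{1..r}. ix a < c \<and> p (ix a) < v))"
proof (induction r arbitrary: c v)
  case 0
  show ?case by (simp add: strict_mono_on_def)
next
  case (Suc r)
  show ?case
  proof
    assume "chain A p (Suc r) c v"
    then obtain c' where c': "c' \<in> A" "c' < c" "p c' < v" and "chain A p r c' (p c')"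
      by auto
    then obtain ix where ix: "ix ` {1..r} \<subseteq> A" "strict_mono_on {1..r} ix"
        "strict_mono_on {1..r} (p \<circ> ix)" "\<forall>a\<in>{1..r}. ix a < c' \<and> p (ix a) < p c'"
      unfolding Suc.IH by blast
    let ?ix = "ix(Suc r := c')"
    have "\<forall>a\<in>{1..r}. ix a < c \<and> p (ix a) < v"
      using ix(4) c' by (meson order.strict_trans)
    then have "\<forall>a\<in>{1..Suc r}. ?ix a < c \<and> p (?ix a) < v"
      using c' by (auto simp: le_Suc_eq)
    moreover have "?ix ` {1..Suc r} \<subseteq> A"
      using ix(1) c'(1) by (auto simp: le_Suc_eq)
    moreover have "strict_mono_on {1..Suc r} ?ix" "strict_mono_on {1..Suc r} (p \<circ> ?ix)"
      using ix by (auto simp: strict_mono_on_def le_Suc_eq)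
    ultimately show "\<exists>ix. ix ` {1..Suc r} \<subseteq> A \<and> strict_mono_on {1..Suc r} ix \<and>
        strict_mono_on {1..Suc r} (p \<circ> ix) \<and> (\<forall>a\<in>{1..Suc r}. ix a < c \<and> p (ix a) < v)"
      by blast
  next
    assume "\<exists>ix. ix ` {1..Suc r} \<subseteq> A \<and> strict_mono_on {1..Suc r} ix \<and>
        strict_mono_on {1..Suc r} (p \<circ> ix) \<and> (\<forall>a\<in>{1..Suc r}. ix a < c \<and> p (ix a) < v)"
    then obtain ix where ix: "ix ` {1..Suc r} \<subseteq> A" "strict_mono_on {1..Suc r} ix"
        "strict_mono_on {1..Suc r} (p \<circ> ix)" "\<forall>a\<in>{1..Suc r}. ix a < c \<and> p (ix a) < v"
      by blast
    have "ix ` {1..r} \<subseteq> A" "strict_mono_on {1..r} ix" "strict_mono_on {1..r} (p \<circ> ix)"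
        "\<forall>a\<in>{1..r}. ix a < ix (Suc r) \<and> p (ix a) < p (ix (Suc r))"
      using ix(1,2,3) by (auto simp: strict_mono_on_def)
    then have "chain A p r (ix (Suc r)) (p (ix (Suc r)))"
      unfolding Suc.IH by blast
    then show "chain A p (Suc r) c v"
      using ix(1,4) by (auto intro!: bexI[of _ "ix (Suc r)"])
  qed
qed

section \<open>Pattern occurrences in terms of chains\<close>

text \<open>One direction suffices: the letters of an injective pattern are distinct, so the
  converse follows by trichotomy.\<close>

lemma order_isomorphicI:
  assumes "inj_on t {1..k}"
    and "\<And>a b. a \<in> {1..k} \<Longrightarrow> b \<in> {1..k} \<Longrightarrow> t a < t b \<Longrightarrow> w a < w b"
  shows "order_isomorphic k w t"
  unfolding order_isomorphic_def
proof (intro ballI iffI)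
  fix a b assume ab: "a \<in> {1..k}" "b \<in> {1..k}" and less: "w a < w b"
  show "t a < t b"
  proof (rule ccontr)
    assume "\<not> t a < t b"
    then consider "t a = t b" | "t b < t a" by linarith
    then show False
      using assms ab less by cases (auto dest: inj_onD order.strict_trans)
  qed
qed (use assms in auto)

text \<open>The first \<open>K\<close> letters of the pattern lie below both remaining ones, so they
  form a chain left of \<open>i\<close> and below the smaller entry \<open>p j\<close>. The
  parameter \<open>R\<close> carries conditions on the last two indices, serving both plain
  avoidance and \<open>contains_Q\<close>.\<close>

lemma pattern_occurrence_G_iff:
  assumes "k = Suc (Suc K)"
  shows "(\<exists>ix. pattern_occurrence n k (G_pattern k) p ix \<and> R (ix (k - 1)) (ix k)) \<longleftrightarrow>
    (\<exists>i\<in>{1..n}. \<exists>j\<in>{1..n}. i < j \<and> p j < p i \<and> chain {1..n} p K i (p j) \<and> R i j)"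
    (is "?lhs \<longleftrightarrow> ?rhs")
proof
  assume ?lhs
  then obtain ix where ix: "ix ` {1..k} \<subseteq> {1..n}" "strict_mono_on {1..k} ix"
      "order_isomorphic k (p \<circ> ix) (G_pattern k)" and R: "R (ix (k - 1)) (ix k)"
    unfolding pattern_occurrence_def by blast
  have less: "p (ix a) < p (ix b)"
    if "a \<in> {1..k}" "b \<in> {1..k}" "G_pattern k a < G_pattern k b" for a b
    using ix(3) that by (auto simp: order_isomorphic_def)
  have "chain {1..n} p K (ix (k - 1)) (p (ix k))"
    unfolding chain_iff_index
  proof (intro exI[of _ ix] conjI ballI)
    show "ix ` {1..K} \<subseteq> {1..n}" "strict_mono_on {1..K} ix"
      using ix(1,2) assms by (auto simp: strict_mono_on_def)
    show "strict_mono_on {1..K} (p \<circ> ix)"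
      using assms by (auto simp: strict_mono_on_def G_pattern_def intro!: less)
    show "ix a < ix (k - 1)" if "a \<in> {1..K}" for a
      using ix(2) that assms by (auto simp: strict_mono_on_def)
    show "p (ix a) < p (ix k)" if "a \<in> {1..K}" for a
      using that assms by (auto simp: G_pattern_def intro!: less)
  qed
  moreover have "ix (k - 1) < ix k"
    using ix(2) assms by (auto simp: strict_mono_on_def)
  moreover have "ix (k - 1) \<in> {1..n}" "ix k \<in> {1..n}"
    using assms by (intro subsetD[OF ix(1)] imageI; simp)+
  moreover have "p (ix k) < p (ix (k - 1))"
    using assms by (intro less) (auto simp: G_pattern_def)
  ultimately show ?rhs using R by blast
next
  assume ?rhs
  then obtain i j where ij: "i \<in> {1..n}" "j \<in> {1..n}" "i < j" "p j < p i" "R i j"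
    and "chain {1..n} p K i (p j)" by blast
  then obtain ix where ix: "ix ` {1..K} \<subseteq> {1..n}" "strict_mono_on {1..K} ix"
      "strict_mono_on {1..K} (p \<circ> ix)" "\<forall>a\<in>{1..K}. ix a < i \<and> p (ix a) < p j"
    unfolding chain_iff_index by blast
  have below: "\<forall>a\<in>{1..K}. ix a < i \<and> ix a < j \<and> p (ix a) < p i \<and> p (ix a) < p j"
    using ix(4) ij(3,4) by (meson order.strict_trans)
  let ?ix = "ix(k - 1 := i, k := j)"
  have "?ix ` {1..k} \<subseteq> {1..n}"
    using ix(1) ij assms by (auto simp: le_Suc_eq)
  moreover have "strict_mono_on {1..k} ?ix"
    using ix(2) below ij(3) assms by (auto simp: strict_mono_on_def le_Suc_eq)
  moreover have "order_isomorphic k (p \<circ> ?ix) (G_pattern k)"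
  proof (rule order_isomorphicI)
    show "inj_on (G_pattern k) {1..k}"
      using assms by (auto simp: inj_on_def G_pattern_def split: if_splits)
    show "(p \<circ> ?ix) a < (p \<circ> ?ix) b"
      if "a \<in> {1..k}" "b \<in> {1..k}" "G_pattern k a < G_pattern k b" for a b
      using that ix(3) below ij(4) assms
      by (auto simp: G_pattern_def le_Suc_eq strict_mono_on_def split: if_splits)
  qed
  ultimately show ?lhs
    using ij assms unfolding pattern_occurrence_def by (intro exI[of _ ?ix]) simp
qed

text \<open>Here the penultimate letter is the smaller of the last two, hence the bound
  \<open>p i\<close> on the chain; \<open>R\<close> will express the intervening descent of
  \<open>contains_H\<close>.\<close>

lemma pattern_occurrence_J_iff:
  assumes "k = Suc (Suc K)"
  shows "(\<exists>ix. pattern_occurrence n k (J_pattern k) p ix \<and> R (ix (k - 1)) (ix k)) \<longleftrightarrow>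
    (\<exists>i\<in>{1..n}. \<exists>j\<in>{1..n}. i < j \<and> p i < p j \<and> chain {1..n} p K i (p i) \<and> R i j)"
    (is "?lhs \<longleftrightarrow> ?rhs")
proof
  assume ?lhs
  then obtain ix where ix: "ix ` {1..k} \<subseteq> {1..n}" "strict_mono_on {1..k} ix"
      "order_isomorphic k (p \<circ> ix) (J_pattern k)" and R: "R (ix (k - 1)) (ix k)"
    unfolding pattern_occurrence_def by blast
  have less: "p (ix a) < p (ix b)" if "a \<in> {1..k}" "b \<in> {1..k}" "a < b" for a b
    using ix(3) that by (auto simp: order_isomorphic_def J_pattern_def)
  have "chain {1..n} p K (ix (k - 1)) (p (ix (k - 1)))"
    unfolding chain_iff_index
  proof (intro exI[of _ ix] conjI ballI)
    show "ix ` {1..K} \<subseteq> {1..n}" "strict_mono_on {1..K} ix"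
      using ix(1,2) assms by (auto simp: strict_mono_on_def)
    show "strict_mono_on {1..K} (p \<circ> ix)"
      using assms by (auto simp: strict_mono_on_def intro!: less)
    show "ix a < ix (k - 1)" if "a \<in> {1..K}" for a
      using ix(2) that assms by (auto simp: strict_mono_on_def)
    show "p (ix a) < p (ix (k - 1))" if "a \<in> {1..K}" for a
      using that assms by (auto intro!: less)
  qed
  moreover have "ix (k - 1) < ix k"
    using ix(2) assms by (auto simp: strict_mono_on_def)
  moreover have "ix (k - 1) \<in> {1..n}" "ix k \<in> {1..n}"
    using assms by (intro subsetD[OF ix(1)] imageI; simp)+
  moreover have "p (ix (k - 1)) < p (ix k)"
    using assms by (intro less) auto
  ultimately show ?rhs using R by blast
next
  assume ?rhs
  then obtain i j where ij: "i \<in> {1..n}" "j \<in> {1..n}" "i < j" "p i < p j" "R i j"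
    and "chain {1..n} p K i (p i)" by blast
  then obtain ix where ix: "ix ` {1..K} \<subseteq> {1..n}" "strict_mono_on {1..K} ix"
      "strict_mono_on {1..K} (p \<circ> ix)" "\<forall>a\<in>{1..K}. ix a < i \<and> p (ix a) < p i"
    unfolding chain_iff_index by blast
  have below: "\<forall>a\<in>{1..K}. ix a < i \<and> ix a < j \<and> p (ix a) < p i \<and> p (ix a) < p j"
    using ix(4) ij(3,4) by (meson order.strict_trans)
  let ?ix = "ix(k - 1 := i, k := j)"
  have "?ix ` {1..k} \<subseteq> {1..n}"
    using ix(1) ij assms by (auto simp: le_Suc_eq)
  moreover have "strict_mono_on {1..k} ?ix"
    using ix(2) below ij(3) assms by (auto simp: strict_mono_on_def le_Suc_eq)
  moreover have "order_isomorphic k (p \<circ> ?ix) (J_pattern k)"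
  proof (rule order_isomorphicI)
    show "inj_on (J_pattern k) {1..k}"
      by (simp add: inj_on_def J_pattern_def)
    show "(p \<circ> ?ix) a < (p \<circ> ?ix) b"
      if "a \<in> {1..k}" "b \<in> {1..k}" "J_pattern k a < J_pattern k b" for a b
      using that ix(3) below ij(4) assms
      by (auto simp: J_pattern_def le_Suc_eq strict_mono_on_def)
  qed
  ultimately show ?lhs
    using ij assms unfolding pattern_occurrence_def by (intro exI[of _ ?ix]) simp
qed

section \<open>High and low positions and the classes they define\<close>

definition highs :: "nat \<Rightarrow> nat \<Rightarrow> (nat \<Rightarrow> nat) \<Rightarrow> nat set" where
  "highs n K p = {i \<in> {1..n}. chain {1..n} p K i (p i)}"

definition lows :: "nat \<Rightarrow> nat \<Rightarrow> (nat \<Rightarrow> nat) \<Rightarrow> nat set" where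
  "lows n K p = {1..n} - highs n K p"

definition same_low :: "nat \<Rightarrow> nat \<Rightarrow> (nat \<Rightarrow> nat) \<Rightarrow> (nat \<Rightarrow> nat) \<Rightarrow> bool" where
  "same_low n K p q \<longleftrightarrow> highs n K p = highs n K q \<and> (\<forall>i\<in>lows n K p. p i = q i)"

lemma same_low_refl: "same_low n K p p"
  by (simp add: same_low_def)

lemma same_low_sym: "same_low n K p q \<Longrightarrow> same_low n K q p"
  by (simp add: same_low_def lows_def)

lemma same_low_trans: "same_low n K p q \<Longrightarrow> same_low n K q r \<Longrightarrow> same_low n K p r"
  by (auto simp: same_low_def lows_def)

text \<open>A chain of \<open>q\<close> that meets a high position \<open>c'\<close> can be
  rerouted: the chain of \<open>K\<close> low entries below \<open>q c'\<close> is long enough to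
  replace the whole initial part up to and including \<open>c'\<close>. Only low entries remain, and
  there \<open>p\<close> and \<open>q\<close> agree.\<close>

lemma chain_replace_highs:
  assumes low: "\<And>i. i \<in> lows n K p \<Longrightarrow> q i = p i"
    and high: "\<And>i. i \<in> highs n K p \<Longrightarrow> chain (lows n K p) p K i (q i)"
    and "r \<le> K"
  shows "chain {1..n} q r c v \<longleftrightarrow> chain (lows n K p) p r c v"
proof
  show "chain {1..n} q r c v" if "chain (lows n K p) p r c v"
  proof -
    have "chain (lows n K p) q r c v"
      using that low by (simp cong: chain_cong)
    then show ?thesis by (rule chain_subset) (simp add: lows_def)
  qed
  show "chain (lows n K p) p r c v" if "chain {1..n} q r c v"
    using that \<open>r \<le> K\<close>
  proof (induction r arbitrary: c v)
    case (Suc r)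
    then obtain c' where c': "c' \<in> {1..n}" "c' < c" "q c' < v" "chain {1..n} q r c' (q c')"
      by auto
    show ?case
    proof (cases "c' \<in> lows n K p")
      case True
      then show ?thesis using c' Suc.IH[of c' "q c'"] Suc.prems low by auto
    next
      case False
      then have "chain (lows n K p) p K c' (q c')"
        using high c'(1) by (simp add: lows_def)
      then have "chain (lows n K p) p (Suc r) c' (q c')"
        using Suc.prems(2) by (rule chain_le)
      then show ?thesis by (rule chain_mono) (use c' in auto)
    qed
  qed simp
qed

text \<open>This is \<open>chain_replace_highs\<close> with \<open>q = p\<close>, once its second
  hypothesis is known. Strong induction on the position bound supplies it: a high entry
  \<open>c'\<close> of the chain has a chain of length \<open>K\<close> to its left, and the
  induction hypothesis applies to that because \<open>c' < c\<close>.\<close>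

lemma chain_lows:
  assumes "r \<le> K"
  shows "chain {1..n} p r c v \<longleftrightarrow> chain (lows n K p) p r c v"
proof -
  have high: "chain (lows n K p) p r c v" if "chain {1..n} p r c v" "r \<le> K" for r c v
    using that
  proof (induction c arbitrary: r v rule: less_induct)
    case (less c)
    show ?case
    proof (cases r)
      case (Suc s)
      then obtain c' where c': "c' \<in> {1..n}" "c' < c" "p c' < v" "chain {1..n} p s c' (p c')"
        using less.prems by auto
      show ?thesis
      proof (cases "c' \<in> lows n K p")
        case True
        then show ?thesis using c' less.IH[of c' s] less.prems Suc by auto
      next
        case False
        then have "chain {1..n} p K c' (p c')"
          using c' by (simp add: lows_def highs_def)
        then have "chain (lows n K p) p r c' (p c')"
          using less.IH less.prems(2) c' chain_le by blast
        then show ?thesis by (rule chain_mono) (use c' in auto)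
      qed
    qed simp
  qed
  then have "chain (lows n K p) p K i (p i)" if "i \<in> highs n K p" for i
    using that by (simp add: highs_def)
  then show ?thesis using assms by (intro chain_replace_highs) auto
qed

text \<open>By \<open>chain_lows\<close> the test sees only low entries, which \<open>p\<close> and
  \<open>q\<close> share. So whether a value would make a position high is a property of the
  class.\<close>

lemma same_low_chain:
  assumes "same_low n K p q"
  shows "chain {1..n} p K c v \<longleftrightarrow> chain {1..n} q K c v"
proof -
  have "lows n K q = lows n K p"
    using assms by (simp add: same_low_def lows_def)
  moreover have "chain (lows n K p) p K c v \<longleftrightarrow> chain (lows n K p) q K c v"
    using assms by (intro chain_cong) (simp add: same_low_def)
  ultimately show ?thesis
    using chain_lows[of K K n p c v] chain_lows[of K K n q c v] by simp
qed

text \<open>By \<open>chain_replace_highs\<close> the chains of length \<open>K\<close> exist for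
  \<open>p\<close> and \<open>q\<close> under the same bounds, so highness changes nowhere. New high
  values are tested against \<open>p\<close> alone, which makes a swap easy to check.\<close>

lemma same_lowI:
  assumes low: "\<And>i. i \<in> lows n K p \<Longrightarrow> q i = p i"
    and high: "\<And>i. i \<in> highs n K p \<Longrightarrow> chain {1..n} p K i (q i)"
  shows "same_low n K p q"
proof -
  have chain: "chain {1..n} q K c v \<longleftrightarrow> chain {1..n} p K c v" for c v
    using chain_replace_highs[of n K p q K c v] low high chain_lows[of K K n p] by simp
  have "i \<in> highs n K p \<longleftrightarrow> i \<in> highs n K q" for i
  proof (cases "i \<in> highs n K p")
    case True
    then show ?thesis using high[OF True] by (simp add: highs_def chain)
  next
    case False
    then show ?thesis using low[of i] by (auto simp: highs_def chain lows_def)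
  qed
  then show ?thesis using low by (auto simp: same_low_def)
qed

text \<open>Extremal argument: take a member of the finite class of \<open>p\<close> maximising the
  weighted sum \<open>W\<close>. A pair in the wrong order with respect to \<open>w\<close> that
  stays high when swapped could be swapped inside the class, increasing \<open>W\<close>. The two
  representatives come from two choices of \<open>w\<close>.\<close>

lemma exists_no_swap:
  fixes w :: "nat \<Rightarrow> int"
  assumes "p permutes {1..n}"
  obtains q where "q permutes {1..n}" "same_low n K p q"
    "\<And>i j. i \<in> highs n K q \<Longrightarrow> j \<in> highs n K q \<Longrightarrow> w i < w j \<Longrightarrow> q j < q i \<Longrightarrow>
       chain {1..n} q K i (q j) \<Longrightarrow> chain {1..n} q K j (q i) \<Longrightarrow> False"
proof -
  define C where "C = {q. q permutes {1..n} \<and> same_low n K p q}"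
  define W where "W q = (\<Sum>i\<in>{1..n}. w i * int (q i))" for q
  have "finite C" unfolding C_def
    by (rule finite_subset[OF _ finite_permutations[of "{1..n}"]]) auto
  moreover have "C \<noteq> {}" using assms same_low_refl by (auto simp: C_def)
  ultimately obtain q where q: "q \<in> C" and max: "\<And>q'. q' \<in> C \<Longrightarrow> W q' \<le> W q"
    using Max_in[of "W ` C"] Max_ge[of "W ` C"] by (metis (no_types, lifting) finite_imageI
        image_iff image_is_empty)
  have False if ij: "i \<in> highs n K q" "j \<in> highs n K q" and less: "w i < w j" "q j < q i"
    and chains: "chain {1..n} q K i (q j)" "chain {1..n} q K j (q i)" for i j
  proof -
    define q' where "q' = q \<circ> transpose i j"
    have neq: "i \<noteq> j" using less by auto
    have ij': "i \<in> {1..n}" "j \<in> {1..n}" using ij by (auto simp: highs_def)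
    have "q' permutes {1..n}"
      unfolding q'_def using q ij'
      by (intro permutes_compose permutes_swap_id) (auto simp: C_def)
    moreover have "same_low n K q q'"
    proof (rule same_lowI)
      show "q' l = q l" if "l \<in> lows n K q" for l
        using that ij by (auto simp: q'_def lows_def transpose_def)
      show "chain {1..n} q K l (q' l)" if "l \<in> highs n K q" for l
        using that chains by (auto simp: q'_def highs_def transpose_def)
    qed
    ultimately have "q' \<in> C" using q same_low_trans by (auto simp: C_def)
    \<comment> \<open>Only the summands at \<open>i\<close> and \<open>j\<close> change, so the
      difference of the sums factors into two positive numbers.\<close>
    have "W f = w i * int (f i) + w j * int (f j) + (\<Sum>l\<in>{1..n} - {i} - {j}. w l * int (f l))"
      for f using ij' neq by (simp add: W_def sum.remove[of _ i] sum.remove[of _ j])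
    moreover have "(\<Sum>l\<in>{1..n} - {i} - {j}. w l * int (q' l)) =
        (\<Sum>l\<in>{1..n} - {i} - {j}. w l * int (q l))"
      by (rule sum.cong) (auto simp: q'_def transpose_def)
    ultimately have "W q' - W q = (w j - w i) * (int (q i) - int (q j))"
      using neq by (simp add: q'_def algebra_simps)
    also have "\<dots> > 0" using less by simp
    finally show False using max[OF \<open>q' \<in> C\<close>] by simp
  qed
  with that q show thesis by (auto simp: C_def)
qed

section \<open>Descents within a class\<close>

text \<open>If the step were not a descent, the chain below \<open>p i\<close> would also lie left
  of and below the next entry.\<close>

lemma high_low_descent:
  assumes "i \<in> highs n K p" "Suc i \<in> lows n K p"
  shows "p (Suc i) < p i"
proof (rule ccontr)
  assume "\<not> p (Suc i) < p i"
  then have "chain {1..n} p K (Suc i) (p (Suc i))"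
    using assms(1) by (auto simp: highs_def intro: chain_mono)
  then show False using assms(2) by (simp add: lows_def highs_def)
qed

text \<open>The chain below \<open>p (Suc i)\<close> cannot use position \<open>i\<close>, whose
  entry is too large, so it lies entirely left of \<open>i\<close>.\<close>

lemma descent_to_high:
  assumes "Suc i \<in> highs n K p" "p (Suc i) < p i"
  shows "chain {1..n} p K i (p (Suc i))"
proof (cases K)
  case (Suc r)
  then obtain c where c: "c \<in> {1..n}" "c < Suc i" "p c < p (Suc i)" "chain {1..n} p r c (p c)"
    using assms(1) by (auto simp: highs_def)
  moreover have "c \<noteq> i" using c(3) assms(2) by auto
  ultimately show ?thesis using Suc by (auto intro!: bexI[of _ c])
qed simp

text \<open>The right-hand side compares values of \<open>p\<close> only when both ends of a step
  are low, so it depends on the class alone.\<close>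

lemma descent_set_eq:
  assumes "\<And>i. i \<in> highs n K p \<Longrightarrow> Suc i \<in> highs n K p \<Longrightarrow> p i < p (Suc i)"
  shows "descent_set n p = {i. 1 \<le> i \<and> i < n \<and> Suc i \<in> lows n K p \<and>
           (i \<in> lows n K p \<longrightarrow> p i > p (Suc i))}" (is "_ = ?D")
proof -
  have "p i > p (Suc i) \<longleftrightarrow>
      Suc i \<in> lows n K p \<and> (i \<in> lows n K p \<longrightarrow> p i > p (Suc i))" if i: "1 \<le> i" "i < n" for i
  proof (cases "Suc i \<in> highs n K p")
    case True
    have "\<not> p i > p (Suc i)"
    proof
      assume desc: "p i > p (Suc i)"
      \<comment> \<open>A descent into a high position can only start from a high one, which the
        hypothesis excludes.\<close>
      have "chain {1..n} p K i (p i)"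
        using descent_to_high[OF True desc] desc by (auto intro: chain_mono)
      then have "i \<in> highs n K p" using i by (simp add: highs_def)
      then show False using assms[OF _ True] desc by simp
    qed
    then show ?thesis using True by (simp add: lows_def)
  next
    case False
    then have "Suc i \<in> lows n K p" using i by (simp add: lows_def)
    then show ?thesis
      using high_low_descent[of i n K p] i by (auto simp: lows_def)
  qed
  then show ?thesis unfolding descent_set_def Suc_eq_plus1[symmetric] by blast
qed

lemma same_low_descent_set:
  assumes "same_low n K p q"
    and "\<And>i. i \<in> highs n K p \<Longrightarrow> Suc i \<in> highs n K p \<Longrightarrow> p i < p (Suc i)"
    and "\<And>i. i \<in> highs n K q \<Longrightarrow> Suc i \<in> highs n K q \<Longrightarrow> q i < q (Suc i)"
  shows "descent_set n p = descent_set n q"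
proof -
  have "lows n K q = lows n K p"
    using assms(1) by (simp add: same_low_def lows_def)
  then show ?thesis
    using assms(1) descent_set_eq[of n K p, OF assms(2)]
      descent_set_eq[of n K q, OF assms(3)] unfolding same_low_def by auto
qed

section \<open>The member of a class that avoids \<open>G_pattern\<close>\<close>

definition avoids_G :: "nat \<Rightarrow> nat \<Rightarrow> (nat \<Rightarrow> nat) \<Rightarrow> bool" where
  "avoids_G n K p \<longleftrightarrow>
     \<not> (\<exists>i\<in>{1..n}. \<exists>j\<in>{1..n}. i < j \<and> p j < p i \<and> chain {1..n} p K i (p j))"

lemma perms_avoiding_G_eq:
  assumes "k = Suc (Suc K)"
  shows "perms_avoiding n k (G_pattern k) = {p. p permutes {1..n} \<and> avoids_G n K p}"
  using pattern_occurrence_G_iff[OF assms, of n _ "\<lambda>_ _. True"]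
  by (simp only: perms_avoiding_def avoids_G_def simp_thms)

lemma avoids_G_ascent:
  assumes "p permutes {1..n}" "avoids_G n K p" "i \<in> highs n K p" "Suc i \<in> highs n K p"
  shows "p i < p (Suc i)"
proof (rule ccontr)
  assume "\<not> p i < p (Suc i)"
  moreover have "p i \<noteq> p (Suc i)"
    using permutes_inj[OF assms(1)] by (simp add: inj_eq)
  ultimately have "p (Suc i) < p i" by simp
  then show False
    using descent_to_high[OF assms(4)] assms(2,3,4) unfolding avoids_G_def highs_def by blast
qed

text \<open>Suppose \<open>p i < q i\<close> after agreement on all earlier positions. Then
  \<open>q\<close> has the value \<open>p i\<close> at a later \<open>j\<close>; as this value keeps
  \<open>i\<close> high, \<open>i\<close> and \<open>j\<close> complete an occurrence of the pattern
  in \<open>q\<close>.\<close>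

lemma avoids_G_unique_aux:
  assumes p: "p permutes {1..n}" and q: "q permutes {1..n}" "avoids_G n K q"
    and same: "same_low n K p q" and eq: "\<And>j. j < i \<Longrightarrow> p j = q j"
  shows "q i \<le> p i"
proof (rule ccontr)
  assume "\<not> q i \<le> p i"
  then have less: "p i < q i" by simp
  then have i: "i \<in> {1..n}"
    using permutes_not_in[OF p] permutes_not_in[OF q(1)] by fastforce
  obtain j where j: "q j = p i" using permutes_surj[OF q(1)] by (metis surjD)
  have "i < j"
  proof (rule ccontr)
    assume "\<not> i < j"
    with j less have "j < i" by (metis less_irrefl linorder_neqE_nat)
    with eq j have "p j = p i" by simp
    then have "j = i" using permutes_inj[OF p] by (auto dest: injD)
    with \<open>j < i\<close> show False by simp
  qed
  have "j \<in> {1..n}"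
    using permutes_in_image[OF p, of i] permutes_in_image[OF q(1), of j] i j by simp
  \<comment> \<open>Low positions carry equal values in \<open>p\<close> and \<open>q\<close>, so a
    disagreement sits at a high one.\<close>
  have "i \<in> highs n K p"
    using same less i by (auto simp: same_low_def lows_def)
  then have "chain {1..n} q K i (q j)"
    using j same_low_chain[OF same] by (simp add: highs_def)
  then show False
    using q(2) i \<open>j \<in> {1..n}\<close> \<open>i < j\<close> j less unfolding avoids_G_def by metis
qed

lemma avoids_G_unique:
  assumes "p permutes {1..n}" "avoids_G n K p" "q permutes {1..n}" "avoids_G n K q"
    and "same_low n K p q"
  shows "p = q"
proof
  fix i
  show "p i = q i"
  proof (induction i rule: less_induct)
    case (less i)
    then show ?case
      using avoids_G_unique_aux[OF assms(1,3,4,5), of i]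
        avoids_G_unique_aux[OF assms(3,1,2) same_low_sym[OF assms(5)], of i] by simp
  qed
qed

text \<open>The weight of a position is the position itself. For an occurrence ending in
  \<open>i\<close> and \<open>j\<close>, the chain left of \<open>i\<close> and below
  \<open>q j\<close> serves all four combinations of position and value, so the two entries could be
  swapped.\<close>

lemma avoids_G_exists:
  assumes "p permutes {1..n}"
  obtains q where "q permutes {1..n}" "avoids_G n K q" "same_low n K p q"
proof -
  obtain q where q: "q permutes {1..n}" "same_low n K p q"
    and no_swap: "\<And>i j. i \<in> highs n K q \<Longrightarrow> j \<in> highs n K q \<Longrightarrow> int i < int j \<Longrightarrow> q j < q i \<Longrightarrow>
       chain {1..n} q K i (q j) \<Longrightarrow> chain {1..n} q K j (q i) \<Longrightarrow> False"
    using exists_no_swap[OF assms] by blast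
  have "avoids_G n K q" unfolding avoids_G_def
  proof clarify
    fix i j assume ij: "i \<in> {1..n}" "j \<in> {1..n}" "i < j" "q j < q i" "chain {1..n} q K i (q j)"
    have "chain {1..n} q K i (q i)" "chain {1..n} q K j (q j)" "chain {1..n} q K j (q i)"
      using ij(3,4) by (auto intro: chain_mono[OF ij(5)])
    then show False using no_swap[of i j] ij by (simp add: highs_def)
  qed
  with q that show thesis by blast
qed

section \<open>Avoidance of \<open>H_k\<close> and \<open>Q_k\<close>, and the block weights\<close>

definition avoids_H :: "nat \<Rightarrow> nat \<Rightarrow> (nat \<Rightarrow> nat) \<Rightarrow> bool" where
  "avoids_H n K p \<longleftrightarrow>
     \<not> (\<exists>i\<in>{1..n}. \<exists>j\<in>{1..n}. i < j \<and> p i < p j \<and> chain {1..n} p K i (p i) \<and>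
          (\<exists>d\<in>descent_set n p. i \<le> d \<and> d < j))"

definition avoids_Q :: "nat \<Rightarrow> nat \<Rightarrow> (nat \<Rightarrow> nat) \<Rightarrow> bool" where
  "avoids_Q n K p \<longleftrightarrow>
     \<not> (\<exists>i\<in>{1..n}. \<exists>j\<in>{1..n}. i < j \<and> p j < p i \<and> chain {1..n} p K i (p j) \<and>
          (\<forall>l. i \<le> l \<and> l < j - 1 \<longrightarrow> p l < p (l + 1)) \<and> p (j - 1) > p j)"

lemma perms_avoiding_HQ_eq:
  assumes "k = Suc (Suc K)"
  shows "perms_avoiding_HQ n k = {p. p permutes {1..n} \<and> avoids_H n K p \<and> avoids_Q n K p}"
proof -
  have "contains_H n k p \<longleftrightarrow> \<not> avoids_H n K p" for p
    unfolding contains_H_def avoids_H_def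
    using pattern_occurrence_J_iff[OF assms, of n p "\<lambda>i j. \<exists>d\<in>descent_set n p. i \<le> d \<and> d < j"]
    by blast
  moreover have "contains_Q n k p \<longleftrightarrow> \<not> avoids_Q n K p" for p
    unfolding contains_Q_def avoids_Q_def
    using pattern_occurrence_G_iff[OF assms, of n p
        "\<lambda>i j. (\<forall>l. i \<le> l \<and> l < j - 1 \<longrightarrow> p l < p (l + 1)) \<and> p (j - 1) > p j"]
    by blast
  ultimately show ?thesis by (simp add: perms_avoiding_HQ_def)
qed

text \<open>For adjacent positions the condition on the increasing run is vacuous, so a descent
  between them would be an occurrence of \<open>Q_k\<close>.\<close>

lemma avoids_Q_ascent:
  assumes "p permutes {1..n}" "avoids_Q n K p" "i \<in> highs n K p" "Suc i \<in> highs n K p"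
  shows "p i < p (Suc i)"
proof (rule ccontr)
  assume "\<not> p i < p (Suc i)"
  moreover have "p i \<noteq> p (Suc i)"
    using permutes_inj[OF assms(1)] by (simp add: inj_eq)
  ultimately have desc: "p (Suc i) < p i" by simp
  have "i \<in> {1..n}" "Suc i \<in> {1..n}" using assms(3,4) by (auto simp: highs_def)
  then have "\<not> avoids_Q n K p"
    using descent_to_high[OF assms(4) desc] desc unfolding avoids_Q_def not_not
    by (intro bexI[of _ i] bexI[of _ "Suc i"] conjI) auto
  then show False using assms(2) by simp
qed

text \<open>
  The weights order the high positions by decreasing block and, inside a block, from left to right.
\<close>

definition block_weight :: "nat \<Rightarrow> nat set \<Rightarrow> nat \<Rightarrow> int" where
  "block_weight n L i = int i - int (Suc n) * int (card {l\<in>L. l < i})"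

lemma block_weight_less_same:
  assumes "i < j" "{i..<j} \<inter> L = {}"
  shows "block_weight n L i < block_weight n L j"
proof -
  have "l < i" if "l \<in> L" "l < j" for l
  proof -
    have "l \<notin> {i..<j}" using assms(2) that(1) by blast
    then show ?thesis using that(2) by simp
  qed
  then have "{l\<in>L. l < j} = {l\<in>L. l < i}" using assms(1) by auto
  then show ?thesis using assms(1) by (simp add: block_weight_def)
qed

text \<open>The factor \<open>Suc n\<close> exceeds every difference of positions up to
  \<open>n\<close>, so one low position in between outweighs the gain \<open>j - i\<close>.\<close>

lemma block_weight_less_later:
  assumes "i < j" "j \<le> n" "{i..<j} \<inter> L \<noteq> {}"
  shows "block_weight n L j < block_weight n L i"
proof -
  obtain l where l: "l \<in> L" "i \<le> l" "l < j" using assms(3) by auto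
  have "{l\<in>L. l < i} \<subseteq> {l\<in>L. l < j}" using assms(1) by auto
  moreover have "l \<in> {l\<in>L. l < j}" "l \<notin> {l\<in>L. l < i}" using l by auto
  ultimately have "{l\<in>L. l < i} \<subset> {l\<in>L. l < j}" by blast
  then have "card {l\<in>L. l < i} < card {l\<in>L. l < j}" by (intro psubset_card_mono) auto
  then have "int (Suc n) * (int (card {l\<in>L. l < i}) + 1) \<le>
      int (Suc n) * int (card {l\<in>L. l < j})"
    by (intro mult_left_mono) auto
  then have "int (Suc n) * int (card {l\<in>L. l < i}) + int (Suc n) \<le>
      int (Suc n) * int (card {l\<in>L. l < j})"
    by (simp only: distrib_left mult_1_right)
  then show ?thesis unfolding block_weight_def using assms(1,2) by linarith
qed

lemma block_weight_less_iff:
  assumes "i < j" "j \<le> n"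
  shows "block_weight n L i < block_weight n L j \<longleftrightarrow> {i..<j} \<inter> L = {}"
    and "block_weight n L j < block_weight n L i \<longleftrightarrow> {i..<j} \<inter> L \<noteq> {}"
proof -
  have same: "{i..<j} \<inter> L = {} \<Longrightarrow> block_weight n L i < block_weight n L j"
    by (rule block_weight_less_same[OF assms(1)])
  have later: "{i..<j} \<inter> L \<noteq> {} \<Longrightarrow> block_weight n L j < block_weight n L i"
    by (rule block_weight_less_later[OF assms])
  show "block_weight n L i < block_weight n L j \<longleftrightarrow> {i..<j} \<inter> L = {}"
    using same later by (meson order.asym)
  show "block_weight n L j < block_weight n L i \<longleftrightarrow> {i..<j} \<inter> L \<noteq> {}"
    using same later by (meson order.asym)
qed

text \<open>Take the first low position after \<open>i\<close>: the position just before it is high,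
  and \<open>high_low_descent\<close> applies to the step between them.\<close>

lemma descent_before_low:
  assumes "i \<in> highs n K p" "l \<in> lows n K p" "i < l"
  obtains d where "d \<in> descent_set n p" "i \<le> d" "d < l"
proof -
  define m where "m = (LEAST m. i < m \<and> m \<in> lows n K p)"
  have m: "i < m" "m \<in> lows n K p" "m \<le> l"
    using assms LeastI[of "\<lambda>m. i < m \<and> m \<in> lows n K p" l]
      Least_le[of "\<lambda>m. i < m \<and> m \<in> lows n K p" l] by (auto simp: m_def)
  obtain d where d: "m = Suc d" using m(1) by (cases m) auto
  have d_in: "1 \<le> d" "d < n" using assms(1) m d by (auto simp: highs_def lows_def)
  have "d \<in> highs n K p"
  proof (cases "d = i")
    case False
    then have "i < d" using m d by simp
    then have "d \<notin> lows n K p"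
      using not_less_Least[of d "\<lambda>m. i < m \<and> m \<in> lows n K p"] d by (auto simp: m_def)
    then show ?thesis using d_in by (auto simp: lows_def)
  qed (use assms in simp)
  then have "p (Suc d) < p d"
    using high_low_descent[of d n K p] m(2) d by simp
  then have "d \<in> descent_set n p"
    using d_in by (simp add: descent_set_def flip: Suc_eq_plus1)
  then show thesis using that m d by simp
qed

section \<open>Block-sorted permutations\<close>

text \<open>A form of avoiding \<open>H_k\<close> and \<open>Q_k\<close> that does not mention
  descents. Distinct positions up to \<open>n\<close> have distinct weights, so the order of all
  high entries is prescribed.\<close>

definition block_sorted :: "nat \<Rightarrow> nat \<Rightarrow> (nat \<Rightarrow> nat) \<Rightarrow> bool" where
  "block_sorted n K p \<longleftrightarrow> (\<forall>i\<in>highs n K p. \<forall>j\<in>highs n K p.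
     block_weight n (lows n K p) i < block_weight n (lows n K p) j \<longrightarrow> p i < p j)"

text \<open>Inside a block, avoiding \<open>Q_k\<close> gives an ascent at every single step. Across
  blocks, \<open>descent_before_low\<close> finds a descent between the two positions, and avoiding
  \<open>H_k\<close> then forbids the later entry to be larger.\<close>

lemma avoids_HQ_imp_block_sorted:
  assumes p: "p permutes {1..n}" and H: "avoids_H n K p" and Q: "avoids_Q n K p"
  shows "block_sorted n K p"
  unfolding block_sorted_def
proof (intro ballI impI)
  fix i j assume ij: "i \<in> highs n K p" "j \<in> highs n K p"
    and less: "block_weight n (lows n K p) i < block_weight n (lows n K p) j"
  have ij': "i \<in> {1..n}" "j \<in> {1..n}" using ij by (auto simp: highs_def)
  \<comment> \<open>In the first case both positions share a block; in the second a low position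
    separates them.\<close>
  consider "i < j" | "j < i" using less by (metis less_irrefl linorder_neqE_nat)
  then show "p i < p j"
  proof cases
    case 1
    then have block: "{i..<j} \<inter> lows n K p = {}"
      using less ij' by (simp add: block_weight_less_iff)
    have high: "m \<in> highs n K p" if "i \<le> m" "m \<le> j" for m
    proof (cases "m = j")
      case False
      then have "m \<in> {i..<j}" using that by simp
      then have "m \<notin> lows n K p" using block by blast
      then show ?thesis using that ij' by (simp add: lows_def)
    qed (use ij in simp)
    have "m \<le> j \<longrightarrow> p i < p m" if "Suc i \<le> m" for m
      using that
    proof (induction m rule: dec_induct)
      case base
      show ?case using avoids_Q_ascent[OF p Q high high] by simp
    next
      case (step m)
      show ?case
      proof
        assume "Suc m \<le> j"
        then have "p m < p (Suc m)"
          using step.hyps by (intro avoids_Q_ascent[OF p Q] high) auto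
        then show "p i < p (Suc m)" using step.IH \<open>Suc m \<le> j\<close> by simp
      qed
    qed
    then show ?thesis using 1 by simp
  next
    case 2
    then have "{j..<i} \<inter> lows n K p \<noteq> {}"
      using less ij' by (simp add: block_weight_less_iff)
    then obtain l where l: "l \<in> lows n K p" "j \<le> l" "l < i" by auto
    then have "j < l" using ij(2) by (auto simp: lows_def le_less)
    then obtain d where d: "d \<in> descent_set n p" "j \<le> d" "d < l"
      using descent_before_low[OF ij(2) l(1)] by blast
    have "\<not> p j < p i"
    proof
      assume "p j < p i"
      moreover have "chain {1..n} p K j (p j)" using ij(2) by (simp add: highs_def)
      moreover have "d < i" using d l by simp
      ultimately show False using H ij' 2 d unfolding avoids_H_def by blast
    qed
    moreover have "p j \<noteq> p i"
      using permutes_inj[OF p] 2 by (auto dest: injD)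
    ultimately show ?thesis by simp
  qed
qed

text \<open>For \<open>H_k\<close>: a larger high entry further right must lie in the same block,
  where every step is an ascent. For \<open>Q_k\<close>: if \<open>j - 1\<close> is high, the step
  to \<open>j\<close> is an ascent; if it is low, a descent between \<open>i\<close> and
  \<open>j - 1\<close> breaks the increasing run.\<close>

lemma block_sorted_imp_avoids_HQ:
  assumes sorted: "block_sorted n K p"
  shows "avoids_H n K p" and "avoids_Q n K p"
proof -
  have ascent: "p i < p (Suc i)" if "i \<in> highs n K p" "Suc i \<in> highs n K p" for i
  proof -
    have "block_weight n (lows n K p) i < block_weight n (lows n K p) (Suc i)"
      using that by (intro block_weight_less_same) (auto simp: lows_def)
    then show ?thesis using sorted that by (simp add: block_sorted_def)
  qed
  show "avoids_H n K p" unfolding avoids_H_def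
  proof clarify
    fix i j d assume ij: "i \<in> {1..n}" "j \<in> {1..n}" "i < j" "p i < p j" "chain {1..n} p K i (p i)"
      and d: "d \<in> descent_set n p" "i \<le> d" "d < j"
    have "chain {1..n} p K j (p j)" by (rule chain_mono[OF ij(5)]) (use ij in auto)
    then have high: "i \<in> highs n K p" "j \<in> highs n K p" using ij by (auto simp: highs_def)
    have "\<not> block_weight n (lows n K p) j < block_weight n (lows n K p) i"
      using sorted high ij(4) by (auto simp: block_sorted_def dest: order.asym)
    then have "{i..<j} \<inter> lows n K p = {}"
      using ij(2,3) block_weight_less_iff(2)[of i j n "lows n K p"] by simp
    then have block: "m \<in> highs n K p" if "i \<le> m" "m < j" for m
      using that ij(1,2) by (fastforce simp: lows_def)
    have "d \<in> highs n K p" using block d by simp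
    \<comment> \<open>The fact \<open>block\<close> stops short of \<open>j\<close>, so a step
      ending at \<open>j\<close> itself is a separate case.\<close>
    moreover have "Suc d \<in> highs n K p"
      using block d high by (cases "Suc d = j") simp_all
    ultimately have "p d < p (Suc d)" by (rule ascent)
    then show False using d(1) by (simp add: descent_set_def flip: Suc_eq_plus1)
  qed
  show "avoids_Q n K p" unfolding avoids_Q_def
  proof clarify
    fix i j assume ij: "i \<in> {1..n}" "j \<in> {1..n}" "i < j" "p j < p i" "chain {1..n} p K i (p j)"
      and asc: "\<forall>l. i \<le> l \<and> l < j - 1 \<longrightarrow> p l < p (l + 1)" and desc: "p j < p (j - 1)"
    have "chain {1..n} p K i (p i)" "chain {1..n} p K j (p j)"
      by (rule chain_mono[OF ij(5)]; use ij(3,4) in simp)+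
    then have high: "i \<in> highs n K p" "j \<in> highs n K p" using ij by (auto simp: highs_def)
    have "j - 1 \<in> highs n K p"
    proof (rule ccontr)
      assume no: "j - 1 \<notin> highs n K p"
      then have "j - 1 \<noteq> i" using high by auto
      then have "i < j - 1" "j - 1 \<in> lows n K p" using ij no by (auto simp: lows_def)
      then obtain d where "d \<in> descent_set n p" "i \<le> d" "d < j - 1"
        using descent_before_low[OF high(1)] by blast
      moreover from this have "p d < p (d + 1)" using asc by simp
      ultimately show False by (simp add: descent_set_def)
    qed
    then show False using ascent[of "j - 1"] high ij desc by simp
  qed
qed

text \<open>Two high entries in the wrong order can always be swapped. The delicate case is the
  smaller value moving left within a block: its chain may be taken among low positions, so it misses
  the block and already lies left of \<open>i\<close>.\<close>

lemma block_sorted_exists: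
  assumes "p permutes {1..n}"
  obtains q where "q permutes {1..n}" "block_sorted n K q" "same_low n K p q"
proof -
  let ?w = "block_weight n (lows n K p)"
  obtain q where q: "q permutes {1..n}" "same_low n K p q"
    and no_swap: "\<And>i j. i \<in> highs n K q \<Longrightarrow> j \<in> highs n K q \<Longrightarrow> ?w i < ?w j \<Longrightarrow> q j < q i \<Longrightarrow>
       chain {1..n} q K i (q j) \<Longrightarrow> chain {1..n} q K j (q i) \<Longrightarrow> False"
    using exists_no_swap[OF assms] by blast
  have lows: "lows n K q = lows n K p"
    using q(2) by (simp add: same_low_def lows_def)
  have "block_sorted n K q" unfolding block_sorted_def lows
  proof (intro ballI impI)
    fix i j assume ij: "i \<in> highs n K q" "j \<in> highs n K q" and less: "?w i < ?w j"
    have ij': "i \<in> {1..n}" "j \<in> {1..n}" using ij by (auto simp: highs_def)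
    have neq: "i \<noteq> j" using less by auto
    show "q i < q j"
    proof (rule ccontr)
      assume "\<not> q i < q j"
      moreover have "q i \<noteq> q j"
        using permutes_inj[OF q(1)] neq by (auto dest: injD)
      ultimately have desc: "q j < q i" by simp
      have chains: "chain {1..n} q K i (q i)" "chain {1..n} q K j (q j)"
        using ij by (auto simp: highs_def)
      have "chain {1..n} q K j (q i)"
        using desc by (auto intro: chain_mono[OF chains(2)])
      moreover have "chain {1..n} q K i (q j)"
      proof (cases "i < j")
        case True
        then have block: "{i..<j} \<inter> lows n K q = {}"
          using less ij' lows by (simp add: block_weight_less_iff)
        show ?thesis
        proof (cases K)
          case (Suc r)
          have "chain (lows n K q) q K j (q j)" using chains(2) chain_lows by blast
          then obtain c where c: "c \<in> lows n K q" "c < j" "q c < q j"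
              "chain (lows n K q) q r c (q c)"
            unfolding Suc by auto
          then have "c \<notin> {i..<j}" using block by blast
          then have "c < i" using c(2) by simp
          then have "chain (lows n K q) q K i (q j)" using c unfolding Suc by auto
          then show ?thesis using chain_lows by blast
        qed simp
      next
        case False
        then show ?thesis by (intro chain_mono[OF chains(2)]) auto
      qed
      ultimately show False using no_swap ij less desc by blast
    qed
  qed
  with q that show thesis by blast
qed

text \<open>Analogue of \<open>avoids_G_unique_aux\<close> with weight in place of position. In
  \<open>q\<close> the value \<open>p i\<close> stands at another high position \<open>j\<close>: a
  smaller weight contradicts the agreement, a larger one the sorting of \<open>q\<close>, and equal
  weights are impossible.\<close>

lemma block_sorted_unique_aux:
  assumes p: "p permutes {1..n}" and q: "q permutes {1..n}" "block_sorted n K q"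
    and same: "same_low n K p q"
    and eq: "\<And>j. j \<in> highs n K p \<Longrightarrow>
      block_weight n (lows n K p) j < block_weight n (lows n K p) i \<Longrightarrow> p j = q j"
    and i: "i \<in> highs n K p"
  shows "q i \<le> p i"
proof (rule ccontr)
  let ?w = "block_weight n (lows n K p)"
  assume "\<not> q i \<le> p i"
  then have less: "p i < q i" by simp
  have sets: "lows n K q = lows n K p" "highs n K q = highs n K p"
    using same by (auto simp: same_low_def lows_def)
  obtain j where j: "q j = p i" using permutes_surj[OF q(1)] by (metis surjD)
  have neq: "j \<noteq> i" using j less by auto
  then have "p j \<noteq> p i" using permutes_inj[OF p] by (auto dest: injD)
  moreover have "j \<in> {1..n}"
    using permutes_in_image[OF p, of i] permutes_in_image[OF q(1), of j] i j
    by (simp add: highs_def)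
  \<comment> \<open>At a low \<open>j\<close> the two permutations would agree, giving
    \<open>p j = q j = p i\<close>.\<close>
  ultimately have high: "j \<in> highs n K p"
    using same j by (force simp: same_low_def lows_def)
  have "\<not> ?w j < ?w i" using eq[OF high] j \<open>p j \<noteq> p i\<close> by auto
  moreover have "\<not> ?w i < ?w j"
    using q(2) high i j less unfolding block_sorted_def sets by (metis order.asym)
  moreover have "?w i \<noteq> ?w j"
    using block_weight_less_iff[of i j n "lows n K p"] block_weight_less_iff[of j i n "lows n K p"]
      neq i \<open>j \<in> {1..n}\<close> unfolding highs_def
    by (metis (no_types, lifting) atLeastAtMost_iff less_irrefl linorder_neqE_nat mem_Collect_eq)
  ultimately show False by linarith
qed

lemma block_sorted_unique:
  assumes p: "p permutes {1..n}" "block_sorted n K p"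
    and q: "q permutes {1..n}" "block_sorted n K q"
    and same: "same_low n K p q"
  shows "p = q"
proof (rule ccontr)
  let ?w = "block_weight n (lows n K p)"
  have sets: "lows n K q = lows n K p" "highs n K q = highs n K p"
    using same by (auto simp: same_low_def lows_def)
  define D where "D = {i \<in> highs n K p. p i \<noteq> q i}"
  assume "p \<noteq> q"
  then obtain x where "p x \<noteq> q x" by auto
  moreover from this have "x \<in> {1..n}"
    using permutes_not_in[OF p(1)] permutes_not_in[OF q(1)] by fastforce
  ultimately have "x \<in> D" using same by (auto simp: D_def same_low_def lows_def)
  moreover have "finite D" by (simp add: D_def highs_def)
  \<comment> \<open>At a disagreement of least weight the auxiliary bound applies in both
    directions.\<close>
  ultimately obtain i where i: "i \<in> D" and min: "\<And>j. j \<in> D \<Longrightarrow> ?w i \<le> ?w j"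
    using ex_min_if_finite[of "?w ` D"] by (auto simp: not_less)
  have eq: "p j = q j" if "j \<in> highs n K p" "?w j < ?w i" for j
    using min[of j] that by (auto simp: D_def)
  have "q i \<le> p i"
    using i eq by (intro block_sorted_unique_aux[OF p(1) q same]) (auto simp: D_def)
  moreover have "p i \<le> q i"
    using i eq by (intro block_sorted_unique_aux[OF q(1) p same_low_sym[OF same]])
      (auto simp: D_def sets)
  ultimately show False using i by (simp add: D_def)
qed

section \<open>The descent-preserving bijection\<close>

theorem theorem2:
  fixes n k :: nat
  assumes "k \<ge> 3" and "n \<ge> 1"
  shows "\<exists>f. bij_betw f (perms_avoiding n k (G_pattern k)) (perms_avoiding_HQ n k) \<and>
             (\<forall>p \<in> perms_avoiding n k (G_pattern k). descent_set n (f p) = descent_set n p)"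
proof -
  define K where "K = k - 2"
  have k: "k = Suc (Suc K)" using assms(1) by (simp add: K_def)
  let ?G = "{p. p permutes {1..n} \<and> avoids_G n K p}"
  let ?HQ = "{p. p permutes {1..n} \<and> avoids_H n K p \<and> avoids_Q n K p}"
  have sorted: "p permutes {1..n} \<and> block_sorted n K p" if "p \<in> ?HQ" for p
    using that avoids_HQ_imp_block_sorted by blast
  have "\<exists>q. q \<in> ?HQ \<and> same_low n K p q" if p: "p \<in> ?G" for p
  proof -
    obtain q where "q permutes {1..n}" "block_sorted n K q" "same_low n K p q"
      using block_sorted_exists p by blast
    then show ?thesis using block_sorted_imp_avoids_HQ by blast
  qed
  \<comment> \<open>\<open>f\<close> picks the member of the class of \<open>p\<close> that avoids
    \<open>H_k\<close> and \<open>Q_k\<close>.\<close>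
  then obtain f where f: "p \<in> ?G \<Longrightarrow> f p \<in> ?HQ" "p \<in> ?G \<Longrightarrow> same_low n K p (f p)" for p
    using bchoice[of ?G "\<lambda>p q. q \<in> ?HQ \<and> same_low n K p q"] by blast
  have "bij_betw f ?G ?HQ"
  proof (rule bij_betw_imageI)
    show "inj_on f ?G"
    proof (rule inj_onI)
      fix p q assume pq: "p \<in> ?G" "q \<in> ?G" "f p = f q"
      \<comment> \<open>Equal images put \<open>p\<close> and \<open>q\<close> in one class, where
        the member avoiding \<open>G_pattern\<close> is unique.\<close>
      then have "same_low n K p (f p)" "same_low n K (f p) q"
        using f(2)[of p] f(2)[of q] by (simp_all add: same_low_sym)
      then have "same_low n K p q" by (rule same_low_trans)
      then show "p = q" using pq avoids_G_unique by blast
    qed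
    show "f ` ?G = ?HQ"
    proof
      show "f ` ?G \<subseteq> ?HQ" using f by blast
      show "?HQ \<subseteq> f ` ?G"
      proof
        fix q assume q: "q \<in> ?HQ"
        \<comment> \<open>The preimage is the member of the class of \<open>q\<close> avoiding
          \<open>G_pattern\<close>: \<open>f p\<close> and \<open>q\<close> are block-sorted in the
          same class, hence equal.\<close>
        then obtain p where p: "p \<in> ?G" "same_low n K q p"
          using avoids_G_exists[of q n K] by blast
        have "same_low n K q (f p)"
          by (rule same_low_trans[OF p(2) f(2)[OF p(1)]])
        then have "q = f p"
          using sorted[OF q] sorted[OF f(1)[OF p(1)]] block_sorted_unique by blast
        then show "q \<in> f ` ?G" using p by blast
      qed
    qed
  qed
  moreover have "descent_set n (f p) = descent_set n p" if "p \<in> ?G" for p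
  proof -
    have "f p \<in> ?HQ" "same_low n K (f p) p"
      using f[OF that] by (simp_all add: same_low_sym)
    then show ?thesis
      using that avoids_G_ascent avoids_Q_ascent
      by (intro same_low_descent_set[of _ K]) auto
  qed
  ultimately show ?thesis
    unfolding perms_avoiding_G_eq[OF k] perms_avoiding_HQ_eq[OF k] by blast
qed

end
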